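(* Let $n\ge 1$ be an integer, let $m$ be a real number with $m\ge n$, and put $d=n/m$. Let $\mathcal U$ and $\mathcal W$ be nonempty finite sets and for each $(u,w)\in\mathcal U\times\mathcal W$ let $\alpha_{uw}\in\mathbb R$ and $\beta_{uw}\in[0,1]$; assume there is $(u,w)\in\mathcal U\times\mathcal W$ with $\beta_{uw}\in(0,1]$. Consider the dynamics of $x^k=(x_1^k,\dots,x_n^k)\in\mathbb R^n$, $k\in\mathbb N$, started from an arbitrary $x^0\in\mathbb R^n$: $$x_i^{k+1}=\begin{cases}\min_{u\in\mathcal U}\max_{w\in\mathcal W}\{(1-\beta_{uw})x_i^k+\beta_{uw}x_{i+1}^k+\alpha_{uw}\} & \text{if } 1\le i<n,\\[2pt] \min_{u\in\mathcal U}\max_{w\in\mathcal W}\{(1-\beta_{uw})x_n^k+\beta_{uw}x_1^k+\alpha_{uw}+n\beta_{uw}/d\} & \text{if } i=n.\end{cases}$$ Then the fundamental diagram, that is, the average flow $f$ as a function of the density $d$, is $$f=\min_{u\in\mathcal U}\max_{w\in\mathcal W}\{\alpha_{uw}d+\beta_{uw}\}.$$ Explicitly: for every $i\in\{1,\dots,n\}$ the limit $\bar v=\lim_{k\to\infty}x_i^k/k$ exists, does not depend on $i$ (nor on $x^0$), and the average flow $f:=d\,\bar v$ equals $\min_{u\in\mathcal U}\max_{w\in\mathcal W}\{\alpha_{uw}d+\beta_{uw}\}$.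
   Context: The setting is $n$ vehicles on a one-lane circular road of length $m$; $d=n/m$ is the car density, and $x_i^k$ is the distance travelled by vehicle $i$ up to time $k$, vehicle $i+1$ being ahead of vehicle $i$ (and vehicle $1$ ahead of vehicle $n$). The average car speed is the common growth rate $\bar v=\lim_{k\to\infty}x_i^k/k$, and the average flow is $f=d\,\bar v$. The fundamental diagram is the relation giving $f$ in terms of $d$. *)

theory Defs
  imports Complex_Main
begin

text \<open>
  \<^term>\<open>x k i\<close> is the distance travelled by vehicle \<^term>\<open>i\<close> up to time \<^term>\<open>k\<close>. Only the
  components with index in \<^term>\<open>{1..n::nat}\<close> are meaningful and constrained; the initial
  state \<^term>\<open>x 0\<close> is arbitrary. Vehicle \<^term>\<open>n::nat\<close> follows vehicle 1 one lap ahead, hence the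
  offset \<^term>\<open>real n * \<beta> u w / d\<close>, the length of the road being \<^term>\<open>real n / d\<close>.
\<close>

definition traffic_dynamics ::
  "nat \<Rightarrow> real \<Rightarrow> 'u set \<Rightarrow> 'w set \<Rightarrow> ('u \<Rightarrow> 'w \<Rightarrow> real) \<Rightarrow> ('u \<Rightarrow> 'w \<Rightarrow> real)
    \<Rightarrow> (nat \<Rightarrow> nat \<Rightarrow> real) \<Rightarrow> bool" where
  "traffic_dynamics n d U W \<alpha> \<beta> x \<longleftrightarrow>
    (\<forall>k.
      (\<forall>i. 1 \<le> i \<and> i < n \<longrightarrow>
        x (Suc k) i =
          (MIN u\<in>U. MAX w\<in>W. (1 - \<beta> u w) * x k i + \<beta> u w * x k (i + 1) + \<alpha> u w)) \<and>
      x (Suc k) n =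
        (MIN u\<in>U. MAX w\<in>W.
          (1 - \<beta> u w) * x k n + \<beta> u w * x k 1 + \<alpha> u w + real n * \<beta> u w / d))"

definition has_average_car_speed :: "nat \<Rightarrow> (nat \<Rightarrow> nat \<Rightarrow> real) \<Rightarrow> real \<Rightarrow> bool" where
  "has_average_car_speed n x v \<longleftrightarrow> (\<forall>i\<in>{1..n}. (\<lambda>k. x k i / real k) \<longlonglongrightarrow> v)"

definition average_flow :: "real \<Rightarrow> real \<Rightarrow> real" where
  "average_flow d v = d * v"

end

theory Submission
  imports Defs
begin

text \<open>
  Equally spaced vehicles stay equally spaced: \<open>y k i = v * k + i / d\<close> with
  \<open>v = (MIN u\<in>U. MAX w\<in>W. \<alpha> u w + \<beta> u w / d)\<close> is an orbit of the dynamics. The dynamics is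
  nonexpansive in the supremum norm, so every orbit stays at bounded distance from this one and
  has its growth rate \<open>v\<close>.
\<close>

text \<open>Compare both sides at one pair: \<open>u\<close> attains the outer minimum for
  \<open>g\<close>, and \<open>w\<close> then attains the maximum of \<open>f u\<close>. The sign of
  \<open>a\<close> keeps the maximum over \<open>w\<close> monotone. With \<open>c = 0\<close> this
  gives scaling, with \<open>a = 1\<close> translation.\<close>

lemma MIN_MAX_le_affine:
  fixes f g :: "'u \<Rightarrow> 'w \<Rightarrow> real"
  assumes "finite U" "U \<noteq> {}" "finite W" "W \<noteq> {}" and "0 \<le> a"
    and le: "\<And>u w. u \<in> U \<Longrightarrow> w \<in> W \<Longrightarrow> f u w \<le> a * g u w + c"
  shows "(MIN u\<in>U. MAX w\<in>W. f u w) \<le> a * (MIN u\<in>U. MAX w\<in>W. g u w) + c"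
proof -
  have "(MIN u\<in>U. MAX w\<in>W. g u w) \<in> (\<lambda>u. MAX w\<in>W. g u w) ` U"
    using assms by (intro Min_in) auto
  then obtain u where u: "u \<in> U" "(MIN u\<in>U. MAX w\<in>W. g u w) = (MAX w\<in>W. g u w)"
    by auto
  have "(MAX w\<in>W. f u w) \<in> f u ` W"
    using assms by (intro Max_in) auto
  then obtain w where w: "w \<in> W" "(MAX w\<in>W. f u w) = f u w"
    by auto
  have "(MIN u\<in>U. MAX w\<in>W. f u w) \<le> f u w"
    using assms u w by (metis Min_le finite_imageI imageI)
  also have "\<dots> \<le> a * g u w + c"
    using le u w by blast
  also have "\<dots> \<le> a * (MAX w\<in>W. g u w) + c"
    using assms w by (intro add_right_mono mult_left_mono Max_ge) auto
  finally show ?thesis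
    using u by simp
qed

lemma MIN_MAX_scale:
  fixes f :: "'u \<Rightarrow> 'w \<Rightarrow> real"
  assumes "finite U" "U \<noteq> {}" "finite W" "W \<noteq> {}" and "0 < a"
  shows "(MIN u\<in>U. MAX w\<in>W. a * f u w) = a * (MIN u\<in>U. MAX w\<in>W. f u w)"
proof (rule antisym)
  show "(MIN u\<in>U. MAX w\<in>W. a * f u w) \<le> a * (MIN u\<in>U. MAX w\<in>W. f u w)"
    using MIN_MAX_le_affine[of U W a "\<lambda>u w. a * f u w" f 0] assms by simp
  \<comment> \<open>The reverse bound is the same lemma, with factor \<open>1 / a\<close> and the
    two functions swapped.\<close>
  have "(MIN u\<in>U. MAX w\<in>W. f u w) \<le> (1 / a) * (MIN u\<in>U. MAX w\<in>W. a * f u w) + 0"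
    using assms by (intro MIN_MAX_le_affine) auto
  then show "a * (MIN u\<in>U. MAX w\<in>W. f u w) \<le> (MIN u\<in>U. MAX w\<in>W. a * f u w)"
    using \<open>0 < a\<close> by (simp add: field_simps)
qed

lemma MIN_MAX_translate_dist_le:
  fixes f g :: "'u \<Rightarrow> 'w \<Rightarrow> real"
  assumes "finite U" "U \<noteq> {}" "finite W" "W \<noteq> {}"
    and le: "\<And>u w. u \<in> U \<Longrightarrow> w \<in> W \<Longrightarrow> \<bar>f u w - (g u w + c)\<bar> \<le> C"
  shows "\<bar>(MIN u\<in>U. MAX w\<in>W. f u w) - ((MIN u\<in>U. MAX w\<in>W. g u w) + c)\<bar> \<le> C"
proof -
  have "(MIN u\<in>U. MAX w\<in>W. f u w) \<le> 1 * (MIN u\<in>U. MAX w\<in>W. g u w) + (c + C)"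
    using assms(1-4) by (intro MIN_MAX_le_affine) (use le in \<open>fastforce simp: abs_le_iff\<close>)+
  moreover have "(MIN u\<in>U. MAX w\<in>W. g u w) \<le> 1 * (MIN u\<in>U. MAX w\<in>W. f u w) + (C - c)"
    using assms(1-4) by (intro MIN_MAX_le_affine) (use le in \<open>fastforce simp: abs_le_iff\<close>)+
  ultimately show ?thesis
    by linarith
qed

text \<open>The difference is itself a convex combination of \<open>p - p'\<close> and
  \<open>q - q'\<close>. This is where nonexpansiveness rests on the weights lying in [0,1].\<close>

lemma convex_comb_dist_le:
  fixes b :: real
  assumes "b \<in> {0..1}" "\<bar>p - p'\<bar> \<le> C" "\<bar>q - q'\<bar> \<le> C"
  shows "\<bar>((1 - b) * p + b * q) - ((1 - b) * p' + b * q')\<bar> \<le> C"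
proof -
  have "\<bar>((1 - b) * p + b * q) - ((1 - b) * p' + b * q')\<bar> = \<bar>(1 - b) * (p - p') + b * (q - q')\<bar>"
    by (simp add: algebra_simps)
  also have "\<dots> \<le> (1 - b) * \<bar>p - p'\<bar> + b * \<bar>q - q'\<bar>"
    using assms(1) abs_triangle_ineq[of "(1 - b) * (p - p')" "b * (q - q')"]
    by (simp add: abs_mult)
  also have "\<dots> \<le> C"
    using assms by (intro convex_bound_le) auto
  finally show ?thesis .
qed

lemma traffic_dynamics_dist_uniform_le:
  fixes n :: nat and d :: real and \<alpha> \<beta> :: "'u \<Rightarrow> 'w \<Rightarrow> real"
  assumes fin: "finite U" "U \<noteq> {}" "finite W" "W \<noteq> {}"
    and n: "n \<ge> 1"
    and \<beta>: "\<And>u w. u \<in> U \<Longrightarrow> w \<in> W \<Longrightarrow> \<beta> u w \<in> {0..1}"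
    and dyn: "traffic_dynamics n d U W \<alpha> \<beta> x"
    and init: "\<And>i. i \<in> {1..n} \<Longrightarrow> \<bar>x 0 i - real i / d\<bar> \<le> C"
    and v: "v = (MIN u\<in>U. MAX w\<in>W. \<alpha> u w + \<beta> u w / d)"
  shows "i \<in> {1..n} \<Longrightarrow> \<bar>x k i - (v * real k + real i / d)\<bar> \<le> C"
proof (induction k arbitrary: i)
  case 0
  then show ?case using init by simp
next
  case (Suc k)
  \<comment> \<open>Here \<open>y\<close> is the reference position of a vehicle and
    \<open>y + 1 / d\<close> that of its leader. Their convex combination with weight
    \<open>\<beta> u w\<close> is \<open>y + \<beta> u w / d\<close>, so the reference update is
    exactly \<open>v + y\<close>.\<close>
  have step: "\<bar>(MIN u\<in>U. MAX w\<in>W. (1 - \<beta> u w) * p + \<beta> u w * q + \<alpha> u w) - (v + y)\<bar> \<le> C"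
    if "\<bar>p - y\<bar> \<le> C" "\<bar>q - (y + 1 / d)\<bar> \<le> C" for p q y
    unfolding v
  proof (rule MIN_MAX_translate_dist_le[OF fin])
    fix u w assume "u \<in> U" "w \<in> W"
    from convex_comb_dist_le[OF \<beta>[OF this] that]
    show "\<bar>(1 - \<beta> u w) * p + \<beta> u w * q + \<alpha> u w - (\<alpha> u w + \<beta> u w / d + y)\<bar> \<le> C"
      by (simp add: algebra_simps)
  qed
  show ?case
  proof (cases "i = n")
    case True
    \<comment> \<open>The lap offset is absorbed into the leader: vehicle 1 moved ahead by
      \<open>real n / d\<close> acts as vehicle \<open>n + 1\<close>, with reference position
      \<open>v * real k + real (n + 1) / d\<close>, so \<open>step\<close> applies
      unchanged.\<close>
    have eq: "(1 - b) * p + b * q + a + real n * b / d = (1 - b) * p + b * (q + real n / d) + a"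
      for a b p q :: real
      by (simp add: algebra_simps)
    have "x (Suc k) i = (MIN u\<in>U. MAX w\<in>W.
        (1 - \<beta> u w) * x k n + \<beta> u w * (x k 1 + real n / d) + \<alpha> u w)"
      using dyn True unfolding traffic_dynamics_def eq by blast
    then show ?thesis
      using step[of "x k n" "v * real k + real n / d" "x k 1 + real n / d"]
        Suc.IH[of n] Suc.IH[of 1] n True
      by (simp add: algebra_simps)
  next
    case False
    then have i: "1 \<le> i" "i < n" using Suc.prems by auto
    then have "x (Suc k) i =
        (MIN u\<in>U. MAX w\<in>W. (1 - \<beta> u w) * x k i + \<beta> u w * x k (i + 1) + \<alpha> u w)"
      using dyn unfolding traffic_dynamics_def by blast
    then show ?thesis
      using step[of "x k i" "v * real k + real i / d" "x k (i + 1)"]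
        Suc.IH[of i] Suc.IH[of "i + 1"] i
      by (simp add: algebra_simps add_divide_distrib)
  qed
qed

lemma tendsto_slope_if_bounded_dist:
  fixes f :: "nat \<Rightarrow> real"
  assumes "\<And>k. \<bar>f k - (v * real k + c)\<bar> \<le> C"
  shows "(\<lambda>k. f k / real k) \<longlonglongrightarrow> v"
proof (rule LIM_zero_cancel)
  have bd: "\<bar>f k - v * real k\<bar> \<le> C + \<bar>c\<bar>" for k
    using assms[of k] by linarith
  show "(\<lambda>k. f k / real k - v) \<longlonglongrightarrow> 0"
  proof (rule tendsto_0_le)
    show "(\<lambda>k. (C + \<bar>c\<bar>) / real k) \<longlonglongrightarrow> 0"
      by (rule lim_const_over_n)
    show "\<forall>\<^sub>F k in sequentially. norm (f k / real k - v) \<le> norm ((C + \<bar>c\<bar>) / real k) * 1"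
      \<comment> \<open>At \<open>k = 0\<close> division by zero yields 0, and the quotient identity
        below would fail unless \<open>v = 0\<close>.\<close>
      using eventually_gt_at_top[of 0]
    proof eventually_elim
      case (elim k)
      then have "f k / real k - v = (f k - v * real k) / real k"
        by (simp add: field_simps)
      moreover have "\<bar>f k - v * real k\<bar> \<le> \<bar>C + \<bar>c\<bar>\<bar>"
        using bd[of k] by linarith
      ultimately show ?case
        by (simp add: divide_right_mono)
    qed
  qed
qed

theorem corollary4:
  fixes n :: nat and m d :: real
    and U :: "'u set" and W :: "'w set"
    and \<alpha> \<beta> :: "'u \<Rightarrow> 'w \<Rightarrow> real"
  assumes "n \<ge> 1" and "m \<ge> real n" and "d = real n / m"
    and "finite U" and "U \<noteq> {}" and "finite W" and "W \<noteq> {}"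
    and "\<And>u w. u \<in> U \<Longrightarrow> w \<in> W \<Longrightarrow> \<beta> u w \<in> {0..1}"
    and "\<exists>u\<in>U. \<exists>w\<in>W. \<beta> u w \<in> {0<..1}"
  shows "\<exists>v. (\<forall>x. traffic_dynamics n d U W \<alpha> \<beta> x \<longrightarrow> has_average_car_speed n x v) \<and>
             average_flow d v = (MIN u\<in>U. MAX w\<in>W. \<alpha> u w * d + \<beta> u w)"
proof -
  \<comment> \<open>The advance per time step when every headway is \<open>1 / d\<close>. It is
    fixed before \<open>x\<close>, so one speed serves all initial states.\<close>
  define v where "v = (MIN u\<in>U. MAX w\<in>W. \<alpha> u w + \<beta> u w / d)"
  have d: "0 < d" using assms(1-3) by simp
  have "has_average_car_speed n x v" if dyn: "traffic_dynamics n d U W \<alpha> \<beta> x" for x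
  proof -
    \<comment> \<open>The largest initial deviation from equal spacing, taken over finitely many
      vehicles.\<close>
    define C where "C = (MAX i\<in>{1..n}. \<bar>x 0 i - real i / d\<bar>)"
    have init: "\<bar>x 0 i - real i / d\<bar> \<le> C" if "i \<in> {1..n}" for i
      unfolding C_def using that by (intro Max_ge) auto
    have "\<bar>x k i - (v * real k + real i / d)\<bar> \<le> C" if "i \<in> {1..n}" for i k
      by (rule traffic_dynamics_dist_uniform_le[OF assms(4-7,1,8) dyn init v_def that])
    then show ?thesis
      unfolding has_average_car_speed_def by (intro ballI tendsto_slope_if_bounded_dist)
  qed
  moreover have "average_flow d v = (MIN u\<in>U. MAX w\<in>W. \<alpha> u w * d + \<beta> u w)"
  proof -
    \<comment> \<open>Positivity of \<open>d\<close> lets this common factor leave the min-max,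
      turning speed into flow.\<close>
    have "\<alpha> u w * d + \<beta> u w = d * (\<alpha> u w + \<beta> u w / d)" for u w
      using d by (simp add: field_simps)
    then show ?thesis
      unfolding average_flow_def v_def using MIN_MAX_scale[OF assms(4-7) d] by simp
  qed
  ultimately show ?thesis by blast
qed

end
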